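(* Every almost disjoint family on $\omega$ of cardinality less than $\mathfrak s$ is fin-intersecting.
   Context: An almost disjoint family on $\omega$ is an infinite set $\mathcal A$ of infinite subsets of $\omega$ such that $a\cap b$ is finite for all distinct $a,b\in\mathcal A$. A fin sequence is a function $C:\omega\to[\omega]^{<\omega}\setminus\{\emptyset\}$ with $C(n)\cap C(m)=\emptyset$ whenever $n\neq m$. A collection of sets is centered if every finite nonempty subcollection has infinite intersection. An almost disjoint family $\mathcal A$ is fin-intersecting if for every fin sequence $C$ there exists an infinite $I\subseteq\omega$ such that $\{\{n\in I: a\cap C(n)\neq\emptyset\}: a\in\mathcal A\}\setminus[I]^{<\omega}$ is centered, where $[I]^{<\omega}$ is the set of finite subsets of $I$. $\mathfrak s$ is the least cardinality of a splitting family, i.e. of a collection $\mathcal S$ of infinite subsets of $\omega$ such that for every infinite $X\subseteq\omega$ there is $S\in\mathcal S$ with both $X\cap S$ and $X\setminus S$ infinite. *)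

theory Defs
  imports "HOL-Library.Infinite_Set"
begin

unbundle cardinal_syntax

definition almost_disjoint_family :: "nat set set \<Rightarrow> bool" where
  "almost_disjoint_family A \<longleftrightarrow>
     infinite A \<and> (\<forall>a\<in>A. infinite a) \<and> (\<forall>a\<in>A. \<forall>b\<in>A. a \<noteq> b \<longrightarrow> finite (a \<inter> b))"

definition fin_sequence :: "(nat \<Rightarrow> nat set) \<Rightarrow> bool" where
  "fin_sequence C \<longleftrightarrow>
     (\<forall>n. finite (C n) \<and> C n \<noteq> {}) \<and> (\<forall>n m. n \<noteq> m \<longrightarrow> C n \<inter> C m = {})"

definition centered :: "'a set set \<Rightarrow> bool" where
  "centered \<F> \<longleftrightarrow> (\<forall>\<G>. \<G> \<subseteq> \<F> \<and> finite \<G> \<and> \<G> \<noteq> {} \<longrightarrow> infinite (\<Inter>\<G>))"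

definition fin_intersecting :: "nat set set \<Rightarrow> bool" where
  "fin_intersecting A \<longleftrightarrow>
     (\<forall>C. fin_sequence C \<longrightarrow>
       (\<exists>I. infinite I \<and>
          centered ({{n \<in> I. a \<inter> C n \<noteq> {}} | a. a \<in> A} - {J. J \<subseteq> I \<and> finite J})))"

definition splitting_family :: "nat set set \<Rightarrow> bool" where
  "splitting_family \<S> \<longleftrightarrow>
     (\<forall>S\<in>\<S>. infinite S) \<and>
     (\<forall>X. infinite X \<longrightarrow> (\<exists>S\<in>\<S>. infinite (X \<inter> S) \<and> infinite (X - S)))"

(* Cardinals are canonical cardinal well-orders in the sense of the BNF cardinal theories.
   A least cardinality of a splitting family exists, see splitting_number_least below;
   it is unique only up to the isomorphism =o, which <o does not distinguish. *)
definition splitting_number :: "nat set rel" where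
  "splitting_number =
     (SOME \<kappa>. (\<exists>\<S>. splitting_family \<S> \<and> \<kappa> = |\<S>| ) \<and>
               (\<forall>\<T>. splitting_family \<T> \<longrightarrow> \<kappa> \<le>o |\<T>| ))"

lemma splitting_family_infinite_sets: "splitting_family {S. infinite S}"
proof -
  have "\<exists>S\<in>{S. infinite S}. infinite (X \<inter> S) \<and> infinite (X - S)"
    if X: "infinite X" for X :: "nat set"
  proof -
    let ?e = "enumerate X"
    let ?S = "(\<lambda>n. ?e (2 * n)) ` UNIV" and ?T = "(\<lambda>n. ?e (2 * n + 1)) ` UNIV"
    have mono: "strict_mono ?e"
      using X by (rule strict_mono_enumerate)
    then have inj: "inj ?e"
      by (rule strict_mono_imp_inj_on)
    have "inj (\<lambda>n. ?e (2 * n))" "inj (\<lambda>n. ?e (2 * n + 1))"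
      by (auto intro!: injI dest!: injD[OF inj])
    then have inf: "infinite ?S" "infinite ?T"
      using finite_imageD infinite_UNIV_nat by blast+
    have sub: "?S \<subseteq> X" "?T \<subseteq> X"
      using X enumerate_in_set by auto
    have "?S \<inter> ?T = {}"
    proof -
      have "?e (2 * m) \<noteq> ?e (2 * n + 1)" for m n
        using injD[OF inj, of "2 * m" "2 * n + 1"] by presburger
      then show ?thesis
        by blast
    qed
    then have "?T \<subseteq> X - ?S" and "X \<inter> ?S = ?S"
      using sub by blast+
    then have "infinite (X \<inter> ?S) \<and> infinite (X - ?S)"
      using inf infinite_super by metis
    then show ?thesis
      using inf by blast
  qed
  then show ?thesis
    unfolding splitting_family_def by blast
qed

lemma splitting_number_least:
  "(\<exists>\<S>. splitting_family \<S> \<and> splitting_number = |\<S>| ) \<and>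
   (\<forall>\<T>. splitting_family \<T> \<longrightarrow> splitting_number \<le>o |\<T>| )"
proof -
  let ?R = "{ |\<S>| | \<S>. splitting_family \<S>}"
  have "?R \<noteq> {}"
    using splitting_family_infinite_sets by blast
  moreover have "\<forall>r\<in>?R. Well_order r"
    using card_of_Well_order by blast
  ultimately obtain r where "r \<in> ?R" "\<forall>r'\<in>?R. r \<le>o r'"
    using exists_minim_Well_order[of ?R] by blast
  then have "\<exists>\<kappa>. (\<exists>\<S>. splitting_family \<S> \<and> \<kappa> = |\<S>| ) \<and>
      (\<forall>\<T>. splitting_family \<T> \<longrightarrow> \<kappa> \<le>o |\<T>| )"
    by blast
  then show ?thesis
    unfolding splitting_number_def by (rule someI_ex)
qed

end

theory Submission
  imports Defs
begin

text \<open>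
  For a fin sequence \<open>C\<close>, each \<open>a \<in> A\<close> has a trace, the set of all \<open>n\<close> such that \<open>a\<close> meets
  \<open>C n\<close>. There are at most \<open>|A|\<close> traces, fewer than the splitting number, so some infinite \<open>I\<close>
  is split by none of them (\<open>unsplit_set_exists\<close>): each trace contains almost all or almost
  none of \<open>I\<close>. Discarding the traces that are finite on \<open>I\<close> therefore leaves only cofinite
  subsets of \<open>I\<close>, and these form a centered family (\<open>centered_cofinite_subsets\<close>).
\<close>

lemma unsplit_set_exists:
  fixes \<T> :: "nat set set"
  assumes "|\<T>| <o splitting_number"
  obtains X where "infinite X" "\<And>T. T \<in> \<T> \<Longrightarrow> finite (X \<inter> T) \<or> finite (X - T)"
proof -
  \<comment> \<open>A splitting family must consist of infinite sets; a finite set splits nothing, so the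
      finite members of \<open>\<T>\<close> can be put aside.\<close>
  let ?S = "{T \<in> \<T>. infinite T}"
  have "|?S| \<le>o |\<T>|"
    by (rule card_of_mono1) blast
  then have "|?S| <o splitting_number"
    using assms by (rule ordLeq_ordLess_trans)
  then have "\<not> splitting_family ?S"
    using splitting_number_least not_ordLess_ordLeq by blast
  then obtain X where "infinite X" "\<forall>S\<in>?S. finite (X \<inter> S) \<or> finite (X - S)"
    unfolding splitting_family_def by blast
  then show thesis
    using that by blast
qed

lemma centered_cofinite_subsets:
  assumes "infinite I" and "\<And>J. J \<in> \<F> \<Longrightarrow> J \<subseteq> I \<and> finite (I - J)"
  shows "centered \<F>"
  unfolding centered_def
proof (intro allI impI, elim conjE)
  fix \<G> assume \<G>: "\<G> \<subseteq> \<F>" "finite \<G>" "\<G> \<noteq> {}"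
  have "finite (\<Union>J\<in>\<G>. I - J)"
    using \<G> assms(2) by blast
  then have "infinite (I - (\<Union>J\<in>\<G>. I - J))"
    using assms(1) by (rule Diff_infinite_finite)
  moreover have "I - (\<Union>J\<in>\<G>. I - J) \<subseteq> \<Inter>\<G>"
    by blast
  ultimately show "infinite (\<Inter>\<G>)"
    using infinite_super by blast
qed

theorem theorem11:
  fixes A :: "nat set set"
  assumes "almost_disjoint_family A"
    and "|A| <o splitting_number"
  shows "fin_intersecting A"
  unfolding fin_intersecting_def
proof (intro allI impI)
  fix C :: "nat \<Rightarrow> nat set"
  let ?trace = "\<lambda>a. {n. a \<inter> C n \<noteq> {}}"
  have "|?trace ` A| <o splitting_number"
    using card_of_image assms(2) by (rule ordLeq_ordLess_trans)
  then obtain I where I: "infinite I"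
    and unsplit: "\<And>T. T \<in> ?trace ` A \<Longrightarrow> finite (I \<inter> T) \<or> finite (I - T)"
    by (rule unsplit_set_exists) blast
  have "centered ({{n \<in> I. a \<inter> C n \<noteq> {}} | a. a \<in> A} - {J. J \<subseteq> I \<and> finite J})"
  proof (rule centered_cofinite_subsets[OF I])
    fix J assume J: "J \<in> {{n \<in> I. a \<inter> C n \<noteq> {}} | a. a \<in> A} - {J. J \<subseteq> I \<and> finite J}"
    then obtain a where a: "a \<in> A" and "J = {n \<in> I. a \<inter> C n \<noteq> {}}"
      by blast
    then have J_eq: "J = I \<inter> ?trace a"
      by blast
    then have "infinite (I \<inter> ?trace a)"
      using J by blast
    then have "finite (I - ?trace a)"
      using unsplit a by blast
    moreover have "I - J = I - ?trace a"
      using J_eq by blast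
    ultimately show "J \<subseteq> I \<and> finite (I - J)"
      using J_eq by simp
  qed
  with I show "\<exists>I. infinite I \<and>
      centered ({{n \<in> I. a \<inter> C n \<noteq> {}} | a. a \<in> A} - {J. J \<subseteq> I \<and> finite J})"
    by blast
qed

end
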